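(* Consider binary interval consensus on the complete graph of $n>1$ nodes, i.e. with contact rates $q_{i,j}=1/(n-1)$ for all $i\neq j$, started with $\alpha n$ nodes in state $0$ and $(1-\alpha)n$ nodes in state $1$, where $\alpha\in(1/2,1]$ and $\alpha n$ is an integer. For $i=1,2$ let $T_i$ be the duration of convergence phase $i$. Then for $i=1$ and $i=2$ $$\mathbb{E}(T_i)\le\frac{1}{2\alpha-1}(\log(n)+1).$$
   Context: Binary interval consensus with contact rates $Q=(q_{i,j})$ on $V=\{1,\dots,n\}$ ($Q$ symmetric, non-negative, zero diagonal): each unordered pair of nodes $\{i,j\}$ gets in contact at the instances of a Poisson process of rate $q_{i,j}$, independently over pairs. At each time every node is in one of the four states $0,e_0,e_1,1$. When two nodes get in contact their states are updated as follows (first node, second node): $(0,1)\to(e_1,e_0)$; $(e_0,1)\to(1,e_1)$; $(e_1,0)\to(0,e_0)$; $(e_0,0)\to(0,e_0)$; $(e_1,1)\to(1,e_1)$; $(e_0,e_1)\to(e_1,e_0)$. For any other pair of states nothing changes. Phase 1 begins at time $0$ and lasts until none of the nodes is in state $1$. Phase 2 follows the end of phase 1 and lasts until none of the nodes is in state $e_1$. *)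

theory Defs
  imports "HOL-Probability.Probability"
begin

datatype node_state = Zero | E0 | E1 | One

text \<open>A contact is between an unordered pair of nodes, so each row of the update table is
  entered in both orders.\<close>

fun update_pair :: "node_state \<Rightarrow> node_state \<Rightarrow> node_state \<times> node_state" where
  "update_pair Zero One = (E1, E0)"
| "update_pair One Zero = (E0, E1)"
| "update_pair E0 One = (One, E1)"
| "update_pair One E0 = (E1, One)"
| "update_pair E1 Zero = (Zero, E0)"
| "update_pair Zero E1 = (E0, Zero)"
| "update_pair E0 Zero = (Zero, E0)"
| "update_pair Zero E0 = (E0, Zero)"
| "update_pair E1 One = (One, E1)"
| "update_pair One E1 = (E1, One)"
| "update_pair E0 E1 = (E1, E0)"
| "update_pair E1 E0 = (E0, E1)"
| "update_pair a b = (a, b)"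

definition meet :: "nat \<Rightarrow> nat \<Rightarrow> (nat \<Rightarrow> node_state) \<Rightarrow> nat \<Rightarrow> node_state" where
  "meet i j x = x(i := fst (update_pair (x i) (x j)), j := snd (update_pair (x i) (x j)))"

lemma update_pair_swap: "update_pair b a = prod.swap (update_pair a b)"
  by (cases a; cases b) simp_all

lemma meet_commute: "i \<noteq> j \<Longrightarrow> meet i j x = meet j i x"
  by (auto simp: meet_def fun_eq_iff update_pair_swap[of "x j" "x i"])

definition node_pairs :: "nat \<Rightarrow> nat set set" where
  "node_pairs n = {{i, j} | i j. i \<in> {1..n} \<and> j \<in> {1..n} \<and> i \<noteq> j}"

text \<open>A Poisson process on the positive half-line is given by its random set of instances. The
  probabilities are those of \<^const>\<open>poisson_pmf\<close>, written out because that constant requires a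
  positive parameter, whereas rate zero (no instance, almost surely) is allowed here.\<close>

definition poisson_process :: "'w measure \<Rightarrow> real \<Rightarrow> ('w \<Rightarrow> real set) \<Rightarrow> bool" where
  "poisson_process M r A \<longleftrightarrow>
    (\<forall>\<omega>\<in>space M. A \<omega> \<subseteq> {0<..} \<and> (\<forall>t. finite (A \<omega> \<inter> {0<..t}))) \<and>
    (\<forall>s t. 0 \<le> s \<longrightarrow> s \<le> t \<longrightarrow>
      (\<lambda>\<omega>. card (A \<omega> \<inter> {s<..t})) \<in> measurable M (count_space UNIV) \<and>
      (\<forall>k. measure M {\<omega> \<in> space M. card (A \<omega> \<inter> {s<..t}) = k} =
            (r * (t - s)) ^ k / fact k * exp (- (r * (t - s))))) \<and>
    (\<forall>t :: nat \<Rightarrow> real. 0 \<le> t 0 \<longrightarrow> mono t \<longrightarrow>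
      prob_space.indep_vars M (\<lambda>_. count_space UNIV)
        (\<lambda>k \<omega>. card (A \<omega> \<inter> {t k<..t (Suc k)})) UNIV)"

definition contacts_in ::
    "nat \<Rightarrow> (nat set \<Rightarrow> real set) \<Rightarrow> real \<Rightarrow> real \<Rightarrow> (nat set \<times> real) set" where
  "contacts_in n c s t = {(e, u). e \<in> node_pairs n \<and> u \<in> c e \<and> s < u \<and> u \<le> t}"

text \<open>The last clause says that if the first contact after \<open>s\<close> occurs at \<open>t\<close>, between \<open>i\<close> and
  \<open>j\<close> only, then the states at \<open>t\<close> are the updated states at \<open>s\<close>. Nothing is prescribed at an
  instant where several pairs are in contact, an event of probability zero. In all other cases the
  contact times and the initial states determine the trajectory, which is right-continuous.\<close>

definition consensus_trajectory ::
    "nat \<Rightarrow> (nat set \<Rightarrow> real set) \<Rightarrow> (nat \<Rightarrow> node_state) \<Rightarrow> (real \<Rightarrow> nat \<Rightarrow> node_state) \<Rightarrow> bool" where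
  "consensus_trajectory n c x0 x \<longleftrightarrow>
    x 0 = x0 \<and>
    (\<forall>s t. 0 \<le> s \<longrightarrow> s \<le> t \<longrightarrow> contacts_in n c s t = {} \<longrightarrow> x t = x s) \<and>
    (\<forall>s t i j. 0 \<le> s \<longrightarrow> s < t \<longrightarrow> contacts_in n c s t = {({i, j}, t)} \<longrightarrow> x t = meet i j (x s))"

text \<open>\<open>C e \<omega>\<close> is the set of contact times of the pair \<open>e\<close>, and \<open>X t \<omega> i\<close> is the state of node
  \<open>i\<close> at time \<open>t\<close>.\<close>

locale interval_consensus = prob_space M
  for M :: "'w measure" +
  fixes n :: nat
    and q :: "nat \<Rightarrow> nat \<Rightarrow> real"
    and C :: "nat set \<Rightarrow> 'w \<Rightarrow> real set"
    and x0 :: "nat \<Rightarrow> node_state"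
    and X :: "real \<Rightarrow> 'w \<Rightarrow> nat \<Rightarrow> node_state"
  assumes rate_sym: "i \<in> {1..n} \<Longrightarrow> j \<in> {1..n} \<Longrightarrow> q i j = q j i"
    and rate_nonneg: "i \<in> {1..n} \<Longrightarrow> j \<in> {1..n} \<Longrightarrow> 0 \<le> q i j"
    and rate_diag: "i \<in> {1..n} \<Longrightarrow> q i i = 0"
    and poisson_contacts:
      "i \<in> {1..n} \<Longrightarrow> j \<in> {1..n} \<Longrightarrow> i \<noteq> j \<Longrightarrow> poisson_process M (q i j) (C {i, j})"
    and indep_contacts:
      "indep_vars (\<lambda>_. Pi\<^sub>M {0..} (\<lambda>_. count_space UNIV))
        (\<lambda>e \<omega>. \<lambda>t\<in>{0..}. card (C e \<omega> \<inter> {0<..t})) (node_pairs n)"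
    and trajectory: "AE \<omega> in M. consensus_trajectory n (\<lambda>e. C e \<omega>) x0 (\<lambda>t. X t \<omega>)"

definition phase1_end :: "nat \<Rightarrow> (real \<Rightarrow> nat \<Rightarrow> node_state) \<Rightarrow> ennreal" where
  "phase1_end n x = Inf {ennreal t | t. 0 \<le> t \<and> (\<forall>i\<in>{1..n}. x t i \<noteq> One)}"

definition phase2_end :: "nat \<Rightarrow> (real \<Rightarrow> nat \<Rightarrow> node_state) \<Rightarrow> ennreal" where
  "phase2_end n x =
    Inf {ennreal t | t. 0 \<le> t \<and> phase1_end n x \<le> ennreal t \<and> (\<forall>i\<in>{1..n}. x t i \<noteq> E1)}"

definition phase1_duration :: "nat \<Rightarrow> (real \<Rightarrow> nat \<Rightarrow> node_state) \<Rightarrow> ennreal" where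
  "phase1_duration n x = phase1_end n x"

text \<open>If phase 1 never ends, then this is infinite, as \<^prop>\<open>\<infinity> - \<infinity> = (\<infinity> :: ennreal)\<close>.\<close>

definition phase2_duration :: "nat \<Rightarrow> (real \<Rightarrow> nat \<Rightarrow> node_state) \<Rightarrow> ennreal" where
  "phase2_duration n x = phase2_end n x - phase1_end n x"

end

theory Submission
  imports Defs
begin

text \<open>Let \<open>d = (2 \<alpha> - 1) n\<close>. Only a contact between a node in state \<^const>\<open>Zero\<close> and one in
  state \<^const>\<open>One\<close> changes the number of either, and it removes one of each; hence the difference
  of the two numbers is \<open>d\<close> forever. While \<open>b > 0\<close> nodes are in state \<^const>\<open>One\<close>, at least
  \<open>b + d\<close> are in state \<^const>\<open>Zero\<close>, so \<open>b\<close> drops at rate at least \<open>b d / (n - 1)\<close> and phase 1 takes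
  at most \<open>(n - 1) / d\<close> times a harmonic number in expectation. In phase 2 exactly \<open>d\<close> nodes are
  in state \<^const>\<open>Zero\<close>, each contact between one of them and one of the \<open>k\<close> nodes in state
  \<^const>\<open>E1\<close> lowers \<open>k\<close> by one, and no other contact changes \<open>k\<close>; so \<open>k\<close> drops at rate
  \<open>k d / (n - 1)\<close> and the same bound results.

  In terms of potentials: let \<open>S\<close> be the set of states in which a phase is running. A nonnegative
  function \<open>V\<close> of the state whose infinitesimal drift is at most \<open>-1\<close> on \<open>S\<close> and at most \<open>0\<close>
  elsewhere bounds the expected time spent in \<open>S\<close> by its initial value. For the two phases
  these functions are \<open>(n - 1) / d\<close> times the harmonic number of \<open>b\<close>, respectively of \<open>k\<close>; during
  phase 1 the second one takes the constant value obtained from the harmonic number of \<open>n\<close>,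
  because \<open>k\<close> may grow then.

  The potential argument is carried out without constructing a Markov process. Time is divided
  into slots of length \<open>h\<close>. If no slot up to a horizon \<open>N h\<close> contains two contacts, then the
  trajectory at slot boundaries is determined by a word of \<open>N\<close> labels, each of which says
  that the slot is empty or names the only pair in contact. By independence the probability of a word is the
  product of the weights of its letters (\<open>prob_recorded\<close>). The weighted number of slots that
  start in \<open>S\<close> is then a finite sum, and induction on \<open>N\<close> bounds it by \<open>V\<close>
  (\<open>sum_visits_le\<close>). Pathwise, the duration of a phase exceeds \<open>h\<close> times the number of such slots
  by at most \<open>h\<close>, up to the horizon (\<open>phase1_end_le_visits\<close>, \<open>phase2_end_le_visits\<close>).

  With \<open>h = (1/2)^k\<close> and \<open>N = 3^k\<close> the horizon tends to infinity while the probability that some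
  slot contains two contacts is of order \<open>N h^2 = (3/4)^k\<close>. By Borel-Cantelli, almost surely a
  word describes the trajectory for all large \<open>k\<close>, and Fatou's lemma gives the bound
  (\<open>duration_bound\<close>). The durations themselves are not known to be measurable, so the bound is
  stated through a measurable function above them.\<close>

section \<open>Contacts and state counts\<close>

definition state_count :: "nat \<Rightarrow> node_state \<Rightarrow> (nat \<Rightarrow> node_state) \<Rightarrow> nat" where
  "state_count n s y = card {i \<in> {1..n}. y i = s}"

text \<open>A meeting changes only the states of the two nodes. The old contribution of the two nodes is
  added on the left and the new one on the right, which avoids truncated subtraction.\<close>

lemma state_count_meet:
  assumes "i \<in> {1..n}" "j \<in> {1..n}" "i \<noteq> j"
  shows "state_count n s (meet i j y) + of_bool (y i = s) + of_bool (y j = s)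
    = state_count n s y + of_bool (fst (update_pair (y i) (y j)) = s)
        + of_bool (snd (update_pair (y i) (y j)) = s)"
proof -
  have split: "state_count n s z = of_bool (z i = s) + of_bool (z j = s)
      + card {k \<in> {1..n} - {i, j}. z k = s}" for z
  proof -
    have "state_count n s z = (\<Sum>k\<in>{1..n}. of_bool (z k = s))"
      by (simp add: state_count_def of_bool_def sum.If_cases Int_def)
    also have "\<dots> = of_bool (z i = s) + (of_bool (z j = s) + (\<Sum>k\<in>{1..n} - {i} - {j}. of_bool (z k = s)))"
      using assms by (subst sum.remove[of _ i], simp, simp, subst sum.remove[of _ j]) auto
    also have "(\<Sum>k\<in>{1..n} - {i} - {j}. of_bool (z k = s)) = card {k \<in> {1..n} - {i} - {j}. z k = s}"
      by (simp add: of_bool_def sum.If_cases Int_def)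
    also have "{1..n} - {i} - {j} = {1..n} - {i, j}" by auto
    finally show ?thesis by simp
  qed
  have "{k \<in> {1..n} - {i, j}. meet i j y k = s} = {k \<in> {1..n} - {i, j}. y k = s}"
    by (auto simp: meet_def)
  moreover have "meet i j y i = fst (update_pair (y i) (y j))"
    "meet i j y j = snd (update_pair (y i) (y j))"
    using assms by (simp_all add: meet_def)
  ultimately show ?thesis
    by (simp only: split[of y] split[of "meet i j y"])
qed

lemma meet_balance:
  assumes "i \<in> {1..n}" "j \<in> {1..n}" "i \<noteq> j"
  shows "int (state_count n Zero (meet i j y)) - int (state_count n One (meet i j y))
    = int (state_count n Zero y) - int (state_count n One y)"
  using state_count_meet[OF assms, where s=Zero and y=y] state_count_meet[OF assms, where s=One and y=y]
  by (cases "y i"; cases "y j") auto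

lemma meet_One_le:
  assumes "i \<in> {1..n}" "j \<in> {1..n}" "i \<noteq> j"
  shows "state_count n One (meet i j y) \<le> state_count n One y"
  using state_count_meet[OF assms, where s=One and y=y] by (cases "y i"; cases "y j") auto

lemma meet_Zero_One:
  assumes "i \<in> {1..n}" "j \<in> {1..n}" "y i = Zero" "y j = One"
  shows "Suc (state_count n One (meet i j y)) = state_count n One y"
proof -
  have "i \<noteq> j" using assms by auto
  from state_count_meet[OF assms(1,2) this, where s=One and y=y] assms(3,4) show ?thesis by simp
qed

lemma state_count_eq_0: "state_count n s y = 0 \<longleftrightarrow> (\<forall>i\<in>{1..n}. y i \<noteq> s)"
  by (auto simp: state_count_def card_eq_0_iff)

text \<open>In the absence of state \<^const>\<open>One\<close> no table entry produces a new \<^const>\<open>E1\<close>.\<close>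

lemma meet_E1_le:
  assumes "i \<in> {1..n}" "j \<in> {1..n}" "i \<noteq> j" "state_count n One y = 0"
  shows "state_count n E1 (meet i j y) \<le> state_count n E1 y"
proof -
  have "y i \<noteq> One" "y j \<noteq> One" using assms by (auto simp: state_count_eq_0)
  then show ?thesis
    using state_count_meet[OF assms(1-3), where s=E1 and y=y] by (cases "y i"; cases "y j") auto
qed

lemma meet_Zero_E1:
  assumes "i \<in> {1..n}" "j \<in> {1..n}" "y i = Zero" "y j = E1"
  shows "Suc (state_count n E1 (meet i j y)) = state_count n E1 y"
proof -
  have "i \<noteq> j" using assms by auto
  from state_count_meet[OF assms(1,2) this, where s=E1 and y=y] assms(3,4) show ?thesis by simp
qed

lemma finite_node_pairs: "finite (node_pairs n)"
  by (rule finite_subset[of _ "Pow {1..n}"]) (auto simp: node_pairs_def)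

lemma node_pairsE:
  assumes "e \<in> node_pairs n"
  obtains i j where "i \<in> {1..n}" "j \<in> {1..n}" "i \<noteq> j" "e = {i, j}"
  using assms by (auto simp: node_pairs_def)

primrec apply_contact :: "nat set option \<Rightarrow> (nat \<Rightarrow> node_state) \<Rightarrow> nat \<Rightarrow> node_state" where
  "apply_contact None y = y"
| "apply_contact (Some e) y = meet (Min e) (Max e) y"

text \<open>The updated state does not depend on which of the two nodes is called first, so evaluating
  the pair in increasing order loses nothing.\<close>

lemma apply_contact_pair: "i \<noteq> j \<Longrightarrow> apply_contact (Some {i, j}) y = meet i j y"
  by (cases "i < j") (auto simp: meet_commute min_def max_def)

text \<open>A label describes a slot that contains at most one contact: \<^const>\<open>None\<close> for none, and
  \<^term>\<open>Some e\<close> for a single contact of the pair \<^term>\<open>e\<close>.\<close>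

definition slot_labels :: "nat \<Rightarrow> nat set option set" where
  "slot_labels n = insert None (Some ` node_pairs n)"

lemma finite_slot_labels: "finite (slot_labels n)"
  by (simp add: slot_labels_def finite_node_pairs)

lemma sum_slot_labels:
  "(\<Sum>l\<in>slot_labels n. g l) = g None + (\<Sum>e\<in>node_pairs n. g (Some e))"
  unfolding slot_labels_def
  by (subst sum.insert) (auto simp: finite_node_pairs sum.reindex)

lemma apply_contact_cases:
  assumes "l \<in> slot_labels n"
    and "P y"
    and "\<And>i j. i \<in> {1..n} \<Longrightarrow> j \<in> {1..n} \<Longrightarrow> i \<noteq> j \<Longrightarrow> P (meet i j y)"
  shows "P (apply_contact l y)"
  using assms(1) unfolding slot_labels_def
  by (auto elim!: node_pairsE simp: apply_contact_pair assms(2,3) simp del: apply_contact.simps(2))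

section \<open>Expected occupation along weighted words\<close>

text \<open>The number of letters that are read while the current state lies in the given set; the state
  reached after the last letter is not counted.\<close>

primrec visits :: "('l \<Rightarrow> 's \<Rightarrow> 's) \<Rightarrow> 's set \<Rightarrow> 'l list \<Rightarrow> 's \<Rightarrow> nat" where
  "visits f S [] y = 0"
| "visits f S (l # ls) y = of_bool (y \<in> S) + visits f S ls (f l y)"

lemma visits_eq_sum:
  "visits f S ls y = (\<Sum>m<length ls. of_bool (fold f (take m ls) y \<in> S))"
  by (induction ls arbitrary: y) (simp_all add: sum.lessThan_Suc_shift del: sum.lessThan_Suc)

lemma visits_ge:
  assumes "\<And>m. p \<le> m \<Longrightarrow> m < q \<Longrightarrow> fold f (take m ls) y \<in> S" and "q \<le> length ls"
  shows "q - p \<le> visits f S ls y"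
proof -
  have "q - p = (\<Sum>m\<in>{p..<q}. of_bool (fold f (take m ls) y \<in> S))"
    using assms(1) by simp
  also have "\<dots> \<le> visits f S ls y"
    unfolding visits_eq_sum using assms(2) by (intro sum_mono2) auto
  finally show ?thesis .
qed

lemma fold_take_Suc:
  "m < length ls \<Longrightarrow> fold f (take (Suc m) ls) y = f (ls ! m) (fold f (take m ls) y)"
  by (simp add: take_Suc_conv_app_nth)

abbreviation words :: "'l set \<Rightarrow> nat \<Rightarrow> 'l list set" where
  "words L N \<equiv> {ls. set ls \<subseteq> L \<and> length ls = N}"

lemma sum_words_Suc:
  "(\<Sum>ls\<in>words L (Suc N). g ls) = (\<Sum>l\<in>L. \<Sum>ls\<in>words L N. g (l # ls))"
proof -
  have "words L (Suc N) = (\<lambda>(l, ls). l # ls) ` (L \<times> words L N)"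
    by (auto simp: length_Suc_conv)
  moreover have "inj_on (\<lambda>(l, ls). l # ls) (L \<times> words L N)"
    by (auto simp: inj_on_def)
  ultimately show ?thesis
    by (simp add: sum.reindex sum.cartesian_product case_prod_unfold)
qed

lemma sum_words_weight:
  fixes w :: "'l \<Rightarrow> real"
  shows "(\<Sum>ls\<in>words L N. prod_list (map w ls)) = (\<Sum>l\<in>L. w l) ^ N"
proof (induction N)
  case 0
  have "words L 0 = {[]}" by auto
  then show ?case by simp
next
  case (Suc N)
  then show ?case
    by (simp add: sum_words_Suc sum_distrib_left[symmetric] sum_distrib_right[symmetric])
qed

text \<open>A discrete Lyapunov bound. The weights may sum to less than \<open>1\<close>: mass that is lost to slots
  with several contacts only lowers the left-hand side. One letter costs \<open>c\<close> in \<open>S\<close> and lowers the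
  mean of \<open>V\<close> by at least as much, and the rest of the word is bounded by the induction hypothesis
  at the new state.\<close>

lemma sum_visits_le:
  fixes w :: "'l \<Rightarrow> real" and V :: "'s \<Rightarrow> real"
  assumes w: "\<And>l. l \<in> L \<Longrightarrow> 0 \<le> w l" "(\<Sum>l\<in>L. w l) \<le> 1"
    and c: "0 \<le> c"
    and Inv: "\<And>l y. l \<in> L \<Longrightarrow> Inv y \<Longrightarrow> Inv (f l y)"
    and V: "\<And>y. Inv y \<Longrightarrow> 0 \<le> V y"
    and drift: "\<And>y. Inv y \<Longrightarrow> (\<Sum>l\<in>L. w l * V (f l y)) + c * of_bool (y \<in> S) \<le> V y"
  shows "Inv y \<Longrightarrow> c * (\<Sum>ls\<in>words L N. prod_list (map w ls) * visits f S ls y) \<le> V y"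
proof (induction N arbitrary: y)
  case 0
  have "words L 0 = {[]}" by auto
  then show ?case using V[OF 0] by simp
next
  case (Suc N)
  have "(\<Sum>ls\<in>words L (Suc N). prod_list (map w ls) * visits f S ls y)
    = (\<Sum>l\<in>L. \<Sum>ls\<in>words L N. w l * prod_list (map w ls) * of_bool (y \<in> S)
        + w l * (prod_list (map w ls) * visits f S ls (f l y)))"
    unfolding sum_words_Suc by (intro sum.cong refl) (simp add: distrib_left mult.assoc)
  also have "\<dots> = (\<Sum>l\<in>L. w l) ^ Suc N * of_bool (y \<in> S)
      + (\<Sum>l\<in>L. w l * (\<Sum>ls\<in>words L N. prod_list (map w ls) * visits f S ls (f l y)))"
    by (simp add: sum.distrib sum_distrib_left[symmetric] sum_distrib_right[symmetric]
        sum_words_weight)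
  \<comment> \<open>The total weight of all words is a power of a number in \<open>[0, 1]\<close>.\<close>
  also have "\<dots> \<le> of_bool (y \<in> S)
      + (\<Sum>l\<in>L. w l * (\<Sum>ls\<in>words L N. prod_list (map w ls) * visits f S ls (f l y)))"
    using power_le_one[of "\<Sum>l\<in>L. w l" "Suc N"] w by (auto intro: sum_nonneg)
  finally have "c * (\<Sum>ls\<in>words L (Suc N). prod_list (map w ls) * visits f S ls y)
    \<le> c * (of_bool (y \<in> S)
      + (\<Sum>l\<in>L. w l * (\<Sum>ls\<in>words L N. prod_list (map w ls) * visits f S ls (f l y))))"
    using c by (rule mult_left_mono)
  also have "\<dots> = c * of_bool (y \<in> S)
      + (\<Sum>l\<in>L. w l * (c * (\<Sum>ls\<in>words L N. prod_list (map w ls) * visits f S ls (f l y))))"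
    by (simp add: distrib_left sum_distrib_left mult.left_commute)
  also have "\<dots> \<le> c * of_bool (y \<in> S) + (\<Sum>l\<in>L. w l * V (f l y))"
    using Suc.IH Inv Suc.prems w by (intro add_left_mono sum_mono mult_left_mono) auto
  also have "\<dots> \<le> V y"
    using drift[OF Suc.prems] by simp
  finally show ?case .
qed

section \<open>Words of single contacts along a trajectory\<close>

text \<open>Slots are left-open, like the intervals over which Poisson counts are independent.\<close>

definition records :: "nat \<Rightarrow> (nat set \<Rightarrow> real set) \<Rightarrow> real \<Rightarrow> nat set option list \<Rightarrow> bool" where
  "records n c h ls \<longleftrightarrow> (\<forall>m<length ls. \<forall>e\<in>node_pairs n.
     card (c e \<inter> {real m * h<..real (Suc m) * h}) = of_bool (ls ! m = Some e))"

lemma records_unique: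
  assumes "records n c h ls" "records n c h ls'" "length ls = length ls'"
    "set ls \<subseteq> slot_labels n" "set ls' \<subseteq> slot_labels n"
  shows "ls = ls'"
proof (rule nth_equalityI)
  fix m assume m: "m < length ls"
  have "ls ! m = Some e \<longleftrightarrow> ls' ! m = Some e" if "e \<in> node_pairs n" for e
    using assms(1)[unfolded records_def, rule_format, OF m that]
      assms(2)[unfolded records_def, rule_format, OF m[unfolded assms(3)] that]
    by (simp only: of_bool_eq_iff)
  moreover have "ls ! m \<in> slot_labels n" "ls' ! m \<in> slot_labels n"
    using assms(3-5) m by auto
  ultimately show "ls ! m = ls' ! m"
    unfolding slot_labels_def by (metis imageE insertE)
qed (fact assms(3))

text \<open>The trajectory is constant before and after the only possible contact in the slot,
  and jumps at it. Hence it takes no values in a slot but those at its two ends.\<close>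

lemma trajectory_in_slot:
  assumes traj: "consensus_trajectory n c x0 x"
    and fin: "\<And>e t. e \<in> node_pairs n \<Longrightarrow> finite (c e \<inter> {0<..t})"
    and h: "0 < h" and rec: "records n c h ls" and lab: "set ls \<subseteq> slot_labels n"
    and m: "m < length ls"
  shows "x (real (Suc m) * h) = apply_contact (ls ! m) (x (real m * h))"
    and "real m * h \<le> s \<Longrightarrow> s \<le> real (Suc m) * h \<Longrightarrow>
      x s = x (real m * h) \<or> x s = x (real (Suc m) * h)"
proof -
  define a b where "a = real m * h" and "b = real (Suc m) * h"
  have ab: "0 \<le> a" "a < b" using h by (auto simp: a_def b_def algebra_simps)
  have "\<forall>s t. 0 \<le> s \<longrightarrow> s \<le> t \<longrightarrow> contacts_in n c s t = {} \<longrightarrow> x t = x s"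
    using traj unfolding consensus_trajectory_def by (elim conjE)
  note quiet = this[rule_format]
  have "\<forall>s t i j. 0 \<le> s \<longrightarrow> s < t \<longrightarrow> contacts_in n c s t = {({i, j}, t)} \<longrightarrow> x t = meet i j (x s)"
    using traj unfolding consensus_trajectory_def by (elim conjE)
  note contact = this[rule_format]
  have card: "card (c e \<inter> {a<..b}) = of_bool (ls ! m = Some e)" if "e \<in> node_pairs n" for e
    using rec m that by (simp add: records_def a_def b_def del: of_nat_Suc)
  have fin': "finite (c e \<inter> {a<..b})" if "e \<in> node_pairs n" for e
    using fin[OF that, of b] by (rule finite_subset[rotated]) (use ab in auto)
  have none: "c e \<inter> {a<..b} = {}" if "e \<in> node_pairs n" "ls ! m \<noteq> Some e" for e
    using card[OF that(1)] fin'[OF that(1)] that(2) by simp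
  have "ls ! m \<in> slot_labels n" using lab nth_mem[OF m] by blast
  then consider "ls ! m = None" | e where "ls ! m = Some e" "e \<in> node_pairs n"
    by (auto simp: slot_labels_def)
  then have "x b = apply_contact (ls ! m) (x a) \<and>
    (\<forall>s. a \<le> s \<longrightarrow> s \<le> b \<longrightarrow> x s = x a \<or> x s = x b)"
  proof cases
    case 1
    then have "c e \<inter> {a<..b} = {}" if "e \<in> node_pairs n" for e using none that by simp
    then have "contacts_in n c a s = {}" if "s \<le> b" for s
      using that by (fastforce simp: contacts_in_def)
    then have "x s = x a" if "a \<le> s" "s \<le> b" for s
      using quiet[of a s] ab that by simp
    with 1 ab show ?thesis by (metis apply_contact.simps(1) less_imp_le order_refl)
  next
    case 2
    obtain i j where ij: "i \<noteq> j" "e = {i, j}" using 2 by (auto elim: node_pairsE)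
    obtain u where u: "c e \<inter> {a<..b} = {u}"
      using card[OF 2(2)] 2(1) by (auto simp: card_1_singleton_iff)
    then have u': "u \<in> c e" "a < u" "u \<le> b" by auto
    \<comment> \<open>All contact sets inside the slot are empty or consist of the contact at \<open>u\<close>.\<close>
    have eq: "contacts_in n c s t = {(e, v) | v. v = u \<and> s < u \<and> u \<le> t}" if "a \<le> s" "t \<le> b" for s t
    proof -
      have "(e', v) \<in> contacts_in n c s t \<longleftrightarrow> e' = e \<and> v = u \<and> s < u \<and> u \<le> t" for e' v
      proof
        assume *: "(e', v) \<in> contacts_in n c s t"
        then have v: "e' \<in> node_pairs n" "v \<in> c e' \<inter> {a<..b}"
          using that by (auto simp: contacts_in_def)
        then have "e' = e" using none[of e'] 2 by fastforce
        with v u have "v = u" by auto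
        with * \<open>e' = e\<close> show "e' = e \<and> v = u \<and> s < u \<and> u \<le> t" by (auto simp: contacts_in_def)
      qed (use u' 2 in \<open>auto simp: contacts_in_def\<close>)
      then show ?thesis by auto
    qed
    have before: "x s = x a" if "a \<le> s" "s < u" for s
      using quiet[of a s] eq[of a s] that ab u' by simp
    have "contacts_in n c a u = {({i, j}, u)}"
      using eq[of a u] u' ij by auto
    then have at: "x u = meet i j (x a)"
      using contact[of a u i j] ab u' by simp
    have after: "x b = x s" if "u \<le> s" "s \<le> b" for s
      using quiet[of s b] eq[of s b] that ab u' by simp
    have "x b = apply_contact (ls ! m) (x a)"
      using after[of u] at u' 2 ij by (simp add: apply_contact_pair del: apply_contact.simps(2))
    moreover have "x s = x a \<or> x s = x b" if "a \<le> s" "s \<le> b" for s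
      using before[of s] after[of s] that by (cases "s < u") auto
    ultimately show ?thesis by simp
  qed
  note slot = this[unfolded a_def b_def]
  show "x (real (Suc m) * h) = apply_contact (ls ! m) (x (real m * h))"
    using slot by (rule conjunct1)
  show "x s = x (real m * h) \<or> x s = x (real (Suc m) * h)"
    if "real m * h \<le> s" "s \<le> real (Suc m) * h"
    using slot[THEN conjunct2] that by iprover
qed

section \<open>Phase ends and slot counts\<close>

lemma phase1_end_le:
  "0 \<le> t \<Longrightarrow> state_count n One (x t) = 0 \<Longrightarrow> phase1_end n x \<le> ennreal t"
  unfolding phase1_end_def by (rule Inf_lower) (auto simp only: state_count_eq_0 mem_Collect_eq)

lemma phase1_end_ge:
  assumes "\<And>t. 0 \<le> t \<Longrightarrow> t \<le> a \<Longrightarrow> state_count n One (x t) \<noteq> 0"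
  shows "ennreal a \<le> phase1_end n x"
  unfolding phase1_end_def
proof (rule Inf_greatest)
  fix z assume "z \<in> {ennreal t |t. 0 \<le> t \<and> (\<forall>i\<in>{1..n}. x t i \<noteq> One)}"
  then obtain t where t: "z = ennreal t" "0 \<le> t" "\<forall>i\<in>{1..n}. x t i \<noteq> One" by blast
  then have "\<not> t \<le> a" using assms[of t] unfolding state_count_eq_0 by blast
  then show "ennreal a \<le> z" using t by (auto intro: ennreal_leI)
qed

lemma phase2_end_le:
  "0 \<le> t \<Longrightarrow> phase1_end n x \<le> ennreal t \<Longrightarrow> state_count n E1 (x t) = 0 \<Longrightarrow> phase2_end n x \<le> ennreal t"
  unfolding phase2_end_def by (rule Inf_lower) (auto simp only: state_count_eq_0 mem_Collect_eq)

definition phase1_states :: "nat \<Rightarrow> (nat \<Rightarrow> node_state) set" where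
  "phase1_states n = {y. state_count n One y \<noteq> 0}"

definition phase2_states :: "nat \<Rightarrow> (nat \<Rightarrow> node_state) set" where
  "phase2_states n = {y. state_count n One y = 0 \<and> state_count n E1 y \<noteq> 0}"

lemma apply_contact_phase1_over:
  "l \<in> slot_labels n \<Longrightarrow> y \<notin> phase1_states n \<Longrightarrow> apply_contact l y \<notin> phase1_states n"
  by (rule apply_contact_cases[where P="\<lambda>z. z \<notin> phase1_states n"])
    (use meet_One_le[of _ n _ y] in \<open>auto simp: phase1_states_def\<close>)

text \<open>Slot \<open>m\<close> ends at time \<open>(m + 1) h\<close>; the word \<open>ls\<close> covers the time up to \<open>length ls * h\<close>.\<close>

locale recorded_trajectory =
  fixes n c x0 x h ls
  assumes traj: "consensus_trajectory n c x0 x"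
    and fin: "e \<in> node_pairs n \<Longrightarrow> finite (c e \<inter> {0<..t})"
    and h: "0 < h" and rec: "records n c h ls" and lab: "set ls \<subseteq> slot_labels n"
begin

abbreviation slot_state :: "nat \<Rightarrow> nat \<Rightarrow> node_state" where
  "slot_state m \<equiv> fold apply_contact (take m ls) x0"

lemma slot_state_eq: "m \<le> length ls \<Longrightarrow> x (real m * h) = slot_state m"
proof (induction m)
  case 0
  then show ?case using traj by (simp add: consensus_trajectory_def)
next
  case (Suc m)
  then show ?case
    using trajectory_in_slot(1)[OF traj fin h rec lab, of m]
    by (simp add: fold_take_Suc del: of_nat_Suc)
qed

lemma slot_state_between:
  assumes "m < length ls" "0 \<le> t" "t \<le> real m * h"
  shows "\<exists>k\<le>m. x t = slot_state k"
proof (cases "t = 0")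
  case True
  then show ?thesis using slot_state_eq[of 0] by auto
next
  case False
  define k where "k = nat (\<lfloor>t / h\<rfloor>)"
  have k: "real k * h \<le> t" "t < real (Suc k) * h"
    using h assms(2) floor_divide_lower[OF h, of t] floor_divide_upper[OF h, of t]
    by (auto simp: k_def add.commute)
  then have "real k * h \<le> real m * h" using assms by linarith
  then have "k \<le> m" using h by simp
  show ?thesis
  proof (cases "k = m")
    case True
    then have "t = real m * h" using k assms by simp
    then show ?thesis using slot_state_eq[of m] assms by auto
  next
    case False
    then have "Suc k \<le> m" using \<open>k \<le> m\<close> by simp
    moreover have "x t = slot_state k \<or> x t = slot_state (Suc k)"
      using trajectory_in_slot(2)[OF traj fin h rec lab, of k t] k slot_state_eq[of k]
        slot_state_eq[of "Suc k"] \<open>Suc k \<le> m\<close> assms(1) by (simp del: of_nat_Suc)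
    ultimately show ?thesis by (meson Suc_leD)
  qed
qed

lemma phase1_over_mono:
  assumes "m \<le> k" "k \<le> length ls" "slot_state m \<notin> phase1_states n"
  shows "slot_state k \<notin> phase1_states n"
  using assms
proof (induction k rule: dec_induct)
  case (step k)
  then have "ls ! k \<in> slot_labels n" using lab by (auto simp: subset_iff)
  then show ?case
    using step by (simp add: fold_take_Suc apply_contact_phase1_over)
qed

text \<open>If phase 1 is over at slot boundary \<open>m\<close> for the first time, then all \<open>m\<close> earlier boundaries are
  counted; if it is never over, then all of them are, and the horizon is the minimum.\<close>

lemma phase1_end_le_visits:
  "min (phase1_end n x) (ennreal (real (length ls) * h))
    \<le> ennreal (h * real (visits apply_contact (phase1_states n) ls x0))"
proof (cases "\<exists>m<length ls. slot_state m \<notin> phase1_states n")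
  case True
  define m where "m = (LEAST m. m < length ls \<and> slot_state m \<notin> phase1_states n)"
  from LeastI_ex[OF True] have m: "m < length ls" "slot_state m \<notin> phase1_states n"
    unfolding m_def by auto
  have "slot_state k \<in> phase1_states n" if "k < m" for k
    using not_less_Least[OF that[unfolded m_def]] that m by auto
  then have "m \<le> visits apply_contact (phase1_states n) ls x0"
    using visits_ge[of 0 m apply_contact ls x0 "phase1_states n"] m by auto
  moreover have "phase1_end n x \<le> ennreal (real m * h)"
    using m h by (intro phase1_end_le) (auto simp: slot_state_eq phase1_states_def)
  ultimately show ?thesis
    using h by (intro min.coboundedI1) (auto elim!: order_trans intro!: ennreal_leI simp: mult.commute)
next
  case False
  then have "length ls \<le> visits apply_contact (phase1_states n) ls x0"
    using visits_ge[of 0 "length ls" apply_contact ls x0 "phase1_states n"] by auto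
  then show ?thesis
    using h by (intro min.coboundedI2) (auto intro!: ennreal_leI simp: mult.commute)
qed

text \<open>Phase 1 may end inside the slot before the first boundary at which it is over, which accounts
  for the additional \<open>h\<close>.\<close>

lemma phase1_end_ge_slot:
  assumes "m \<le> length ls" "\<And>k. k < m \<Longrightarrow> slot_state k \<in> phase1_states n"
  shows "ennreal (real m * h) \<le> phase1_end n x + ennreal h"
proof (cases m)
  case (Suc p)
  have "ennreal (real p * h) \<le> phase1_end n x"
  proof (rule phase1_end_ge)
    fix t assume "0 \<le> t" "t \<le> real p * h"
    then obtain k where "k \<le> p" "x t = slot_state k"
      using slot_state_between[of p t] assms Suc by auto
    then show "state_count n One (x t) \<noteq> 0"
      using assms(2)[of k] Suc by (auto simp: phase1_states_def)
  qed
  moreover have "ennreal (real m * h) = ennreal (real p * h) + ennreal h"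
    using h Suc by (subst ennreal_plus[symmetric]) (auto simp: algebra_simps)
  ultimately show ?thesis by (simp add: add_right_mono)
qed simp

text \<open>All boundaries from the first one after phase 1 up to the first one after phase 2 are counted.
  Comparing phase ends rather than durations keeps subtraction out of the statement, which then
  also holds if phase 1 does not end.\<close>

lemma phase2_end_le_visits:
  "min (phase2_end n x) (ennreal (real (length ls) * h))
    \<le> phase1_end n x + ennreal h + ennreal (h * real (visits apply_contact (phase2_states n) ls x0))"
    (is "_ \<le> _ + ennreal (h * real ?v)")
proof -
  define N where "N = length ls"
  have ex: "\<exists>m. m = N \<or> (m < N \<and> slot_state m \<notin> phase1_states n)" by blast
  \<comment> \<open>The boundaries \<open>p\<close> and \<open>q\<close> are those at which the two phases are over, or \<open>N\<close> if the horizon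
    comes first.\<close>
  define p where "p = (LEAST m. m = N \<or> (m < N \<and> slot_state m \<notin> phase1_states n))"
  have p: "p = N \<or> (p < N \<and> slot_state p \<notin> phase1_states n)"
    unfolding p_def using ex by (rule LeastI_ex)
  have before: "slot_state k \<in> phase1_states n" if "k < p" for k
    using not_less_Least[OF that[unfolded p_def]] that p by auto
  have ex2: "\<exists>m. m = N \<or> (p \<le> m \<and> m < N \<and> slot_state m \<notin> phase2_states n)" by blast
  define q where "q = (LEAST m. m = N \<or> (p \<le> m \<and> m < N \<and> slot_state m \<notin> phase2_states n))"
  have q: "q = N \<or> (p \<le> q \<and> q < N \<and> slot_state q \<notin> phase2_states n)"
    unfolding q_def using ex2 by (rule LeastI_ex)
  have during: "slot_state k \<in> phase2_states n" if "p \<le> k" "k < q" for k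
    using not_less_Least[OF that(2)[unfolded q_def]] that q by auto
  have pq: "p \<le> q" "q \<le> N" using p q by auto
  have v: "q - p \<le> ?v"
    using visits_ge[of p q apply_contact ls x0 "phase2_states n"] during pq by (auto simp: N_def)
  have "min (phase2_end n x) (ennreal (real N * h)) \<le> ennreal (real q * h)"
  proof (cases "q = N")
    case False
    then have q': "p \<le> q" "q < N" "slot_state q \<notin> phase2_states n" using q by auto
    then have "slot_state p \<notin> phase1_states n" using p by auto
    then have "slot_state q \<notin> phase1_states n"
      using phase1_over_mono[of p q] q' by (simp add: N_def)
    moreover from this have "state_count n E1 (slot_state q) = 0"
      using q'(3) by (simp add: phase1_states_def phase2_states_def)
    ultimately have "phase2_end n x \<le> ennreal (real q * h)"
      using h q' slot_state_eq[of q]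
      by (intro phase2_end_le phase1_end_le) (auto simp: N_def phase1_states_def)
    then show ?thesis by (rule min.coboundedI1)
  qed simp
  also have "real q * h \<le> real p * h + h * real ?v"
    using v pq h by (simp add: mult.commute[of h] distrib_right[symmetric])
  then have "ennreal (real q * h) \<le> ennreal (real p * h) + ennreal (h * real ?v)"
    using ennreal_leI h by fastforce
  also have "ennreal (real p * h) \<le> phase1_end n x + ennreal h"
    using before pq by (intro phase1_end_ge_slot) (auto simp: N_def)
  finally show ?thesis by (simp add: N_def add_right_mono)
qed

end

section \<open>Probabilities of words\<close>

text \<open>With \<open>k\<close> independent Poisson processes of rate \<open>r\<close>, the probability that a slot of length \<open>h\<close> has
  the given label.\<close>

definition slot_weight :: "real \<Rightarrow> real \<Rightarrow> nat \<Rightarrow> 'e option \<Rightarrow> real" where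
  "slot_weight r h k l = (case l of None \<Rightarrow> 1 | Some e \<Rightarrow> r * h) * exp (- (r * h * real k))"

text \<open>A common rate makes all single contacts equally likely; independence of the contact processes
  can be applied only to a nonempty set of pairs.\<close>

locale uniform_consensus = interval_consensus M n q C x0 X
  for M :: "'w measure" and n q C x0 X +
  fixes r :: real
  assumes r_nonneg: "0 \<le> r"
    and uniform: "i \<in> {1..n} \<Longrightarrow> j \<in> {1..n} \<Longrightarrow> i \<noteq> j \<Longrightarrow> q i j = r"
    and pairs_nonempty: "node_pairs n \<noteq> {}"
begin

lemma poisson: "e \<in> node_pairs n \<Longrightarrow> poisson_process M r (C e)"
  by (metis node_pairsE poisson_contacts uniform)

definition recorded :: "real \<Rightarrow> nat set option list \<Rightarrow> 'w set" where
  "recorded h ls = {\<omega> \<in> space M. records n (\<lambda>e. C e \<omega>) h ls}"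

lemma finite_contacts: "e \<in> node_pairs n \<Longrightarrow> \<omega> \<in> space M \<Longrightarrow> finite (C e \<omega> \<inter> {0<..t})"
  using poisson[of e] by (simp add: poisson_process_def)

lemma card_contacts_diff:
  assumes "e \<in> node_pairs n" "\<omega> \<in> space M" "0 \<le> s" "s \<le> t"
  shows "card (C e \<omega> \<inter> {s<..t}) = card (C e \<omega> \<inter> {0<..t}) - card (C e \<omega> \<inter> {0<..s})"
proof -
  have "C e \<omega> \<inter> {s<..t} = (C e \<omega> \<inter> {0<..t}) - (C e \<omega> \<inter> {0<..s})"
    using assms by auto
  then show ?thesis
    using finite_contacts[OF assms(1,2)] assms(4) by (subst card_Diff_subset[symmetric]) auto
qed

text \<open>A word prescribes, for every pair separately, the increments of its counting path. Independence
  of the paths factors the probability over pairs, independence of increments factors each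
  factor over slots, and exchanging the two products collects the weight of each letter.\<close>

lemma prob_recorded:
  assumes h: "0 < h" and N: "0 < length ls" and lab: "set ls \<subseteq> slot_labels n"
  shows "recorded h ls \<in> events"
    and "prob (recorded h ls) = prod_list (map (slot_weight r h (card (node_pairs n))) ls)"
proof -
  define N where "N = length ls"
  define k where "k m e = (of_bool (ls ! m = Some e) :: nat)" for m e
  define tm where "tm m = real m * h" for m
  define cnt where "cnt e m \<omega> = card (C e \<omega> \<inter> {tm m<..tm (Suc m)})" for e m \<omega>
  define P where "P = (Pi\<^sub>M {0..} (\<lambda>_. count_space UNIV) :: (real \<Rightarrow> nat) measure)"
  define Y where "Y e \<omega> = (\<lambda>t\<in>{0..}. card (C e \<omega> \<inter> {0<..t}))" for e \<omega>
  define A where "A e = {g \<in> space P. \<forall>m\<in>{..<N}. g (tm (Suc m)) - g (tm m) = k m e}" for e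
  have tm: "0 \<le> tm m" "tm m \<le> tm (Suc m)" "mono tm" "tm 0 = 0" for m
    using h by (auto simp: tm_def mono_def mult_right_mono)
  have comp: "(\<lambda>g. g t) \<in> measurable P (count_space UNIV)" if "0 \<le> t" for t
    unfolding P_def using that by (intro measurable_component_singleton) auto
  have "(\<lambda>g. g (tm (Suc m)) - g (tm m)) \<in> measurable P (count_space UNIV)" for m
  proof (rule measurable_compose_countable[where f="\<lambda>i g. g (tm (Suc m)) - i"])
    show "(\<lambda>g. g (tm (Suc m)) - i) \<in> measurable P (count_space UNIV)" for i
      by (rule measurable_compose[OF comp[OF tm(1)] measurable_count_space])
  qed (fact comp[OF tm(1)])
  then have A: "A e \<in> sets P" for e
    unfolding A_def by measurable
  have indep: "indep_vars (\<lambda>_. P) Y (node_pairs n)"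
    using indep_contacts unfolding P_def Y_def .
  have Y_A: "Y e -` A e \<inter> space M = (\<Inter>m\<in>{..<N}. cnt e m -` {k m e} \<inter> space M)"
    if e: "e \<in> node_pairs n" for e
  proof -
    have Y: "Y e \<omega> \<in> space P" for \<omega> by (auto simp: P_def Y_def space_PiM)
    have diff: "Y e \<omega> (tm (Suc m)) - Y e \<omega> (tm m) = cnt e m \<omega>" if "\<omega> \<in> space M" for \<omega> m
      unfolding Y_def cnt_def using card_contacts_diff[OF e that tm(1,2)] tm(1) by simp
    have "\<omega> \<in> Y e -` A e \<inter> space M \<longleftrightarrow> \<omega> \<in> space M \<and> (\<forall>m\<in>{..<N}. cnt e m \<omega> = k m e)" for \<omega>
      using diff[of \<omega>] Y[of \<omega>] by (cases "\<omega> \<in> space M") (simp_all add: A_def)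
    moreover have "0 \<in> {..<N}" using N by (simp add: N_def)
    ultimately show ?thesis by blast
  qed
  have rec: "recorded h ls = (\<Inter>e\<in>node_pairs n. Y e -` A e \<inter> space M)"
  proof -
    have "(\<Inter>e\<in>node_pairs n. Y e -` A e \<inter> space M)
      = (\<Inter>e\<in>node_pairs n. \<Inter>m\<in>{..<N}. cnt e m -` {k m e} \<inter> space M)"
      using Y_A by simp
    also have "\<dots> = recorded h ls"
      using pairs_nonempty N
      by (auto simp: recorded_def records_def cnt_def tm_def k_def N_def simp del: of_nat_Suc)
    finally show ?thesis ..
  qed
  have sets_YA: "Y e -` A e \<inter> space M \<in> events" if "e \<in> node_pairs n" for e
    using indep A that by (auto simp: indep_vars_def intro: measurable_sets)
  then show "recorded h ls \<in> events"
    unfolding rec using pairs_nonempty finite_node_pairs by (intro sets.finite_INT) auto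
  have prob_cnt: "prob (cnt e m -` {k m e} \<inter> space M)
      = (if ls ! m = Some e then r * h else 1) * exp (- (r * h))"
    if e: "e \<in> node_pairs n" for e m
  proof -
    have "cnt e m -` {k m e} \<inter> space M = {\<omega> \<in> space M. card (C e \<omega> \<inter> {tm m<..tm (Suc m)}) = k m e}"
      by (auto simp: cnt_def)
    moreover have "prob \<dots> = (r * (tm (Suc m) - tm m)) ^ k m e / fact (k m e)
        * exp (- (r * (tm (Suc m) - tm m)))"
      using poisson[OF e] tm(1,2)[of m] by (simp add: poisson_process_def)
    moreover have "tm (Suc m) - tm m = h" by (simp add: tm_def algebra_simps)
    ultimately show ?thesis by (simp add: k_def)
  qed
  have prob_path: "prob (Y e -` A e \<inter> space M)
      = (\<Prod>m<N. (if ls ! m = Some e then r * h else 1) * exp (- (r * h)))"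
    if e: "e \<in> node_pairs n" for e
  proof -
    have "indep_vars (\<lambda>_. count_space UNIV) (cnt e) UNIV"
      using poisson[OF e] tm(3,4) unfolding poisson_process_def cnt_def by simp
    from indep_varsD[OF this, of "{..<N}" "\<lambda>m. {k m e}"]
    show ?thesis
      unfolding Y_A[OF e] using N by (simp add: prob_cnt[OF e] N_def lessThan_empty_iff)
  qed
  have weight: "(\<Prod>e\<in>node_pairs n. (if ls ! m = Some e then r * h else 1) * exp (- (r * h)))
    = slot_weight r h (card (node_pairs n)) (ls ! m)" if "m < N" for m
  proof -
    have "ls ! m \<in> slot_labels n" using lab nth_mem[of m ls] that by (auto simp: N_def)
    then consider "ls ! m = None" | e where "ls ! m = Some e" "e \<in> node_pairs n"
      by (auto simp: slot_labels_def)
    then have "(\<Prod>e\<in>node_pairs n. (if ls ! m = Some e then r * h else 1))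
        = (case ls ! m of None \<Rightarrow> 1 | Some e \<Rightarrow> r * h)"
      by cases (auto simp: finite_node_pairs)
    then show ?thesis
      by (simp add: slot_weight_def prod.distrib exp_of_nat_mult[symmetric] mult_ac)
  qed
  have "prob (recorded h ls) = (\<Prod>e\<in>node_pairs n. prob (Y e -` A e \<inter> space M))"
    unfolding rec using indep pairs_nonempty finite_node_pairs A by (intro indep_varsD) auto
  also have "\<dots> = (\<Prod>m<N. \<Prod>e\<in>node_pairs n. (if ls ! m = Some e then r * h else 1) * exp (- (r * h)))"
    by (subst prod.swap) (simp add: prob_path)
  also have "\<dots> = (\<Prod>m<N. slot_weight r h (card (node_pairs n)) (ls ! m))"
    by (intro prod.cong refl weight) auto
  also have "\<dots> = prod_list (map (slot_weight r h (card (node_pairs n))) ls)"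
    by (simp add: prod.list_conv_set_nth N_def atLeast0LessThan)
  finally show "prob (recorded h ls) = \<dots>" .
qed

end

context uniform_consensus
begin

lemma sum_slot_weight:
  "(\<Sum>l\<in>slot_labels n. slot_weight r h (card (node_pairs n)) l)
    = (1 + r * h * card (node_pairs n)) * exp (- (r * h * card (node_pairs n)))"
  by (simp add: sum_slot_labels slot_weight_def distrib_right)

lemma finite_words: "finite (words (slot_labels n) N)"
  using finite_lists_length_eq[OF finite_slot_labels] .

text \<open>The event that none of the first \<open>N\<close> slots contains two contacts.\<close>

definition captured :: "real \<Rightarrow> nat \<Rightarrow> 'w set" where
  "captured h N = (\<Union>ls\<in>words (slot_labels n) N. recorded h ls)"

lemma captured_events: "0 < h \<Longrightarrow> 0 < N \<Longrightarrow> captured h N \<in> events"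
  unfolding captured_def using prob_recorded(1) finite_words by (intro sets.finite_UN) auto

text \<open>Distinct words describe disjoint events, so the captured event has probability \<open>p ^ N\<close>, where
  \<open>p = (1 + x) exp (- x)\<close> is the probability of at most one contact in a slot with mean \<open>x\<close>.
  Bernoulli's inequality and \<open>1 - x^2 \<le> p\<close> give the quadratic bound.\<close>

lemma prob_not_captured:
  assumes h: "0 < h" and N: "0 < N"
  shows "prob (space M - captured h N) \<le> real N * (r * h * card (node_pairs n))\<^sup>2"
proof -
  define x where "x = r * h * card (node_pairs n)"
  define p where "p = (1 + x) * exp (- x)"
  have x: "0 \<le> x" using r_nonneg h by (simp add: x_def)
  have "disjoint_family_on (recorded h) (words (slot_labels n) N)"
    unfolding disjoint_family_on_def recorded_def
    using records_unique by fastforce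
  then have "prob (captured h N) = (\<Sum>ls\<in>words (slot_labels n) N. prob (recorded h ls))"
    unfolding captured_def using prob_recorded(1)[OF h] N finite_words
    by (intro finite_measure_finite_Union) auto
  also have "\<dots> = (\<Sum>ls\<in>words (slot_labels n) N.
      prod_list (map (slot_weight r h (card (node_pairs n))) ls))"
    using N by (intro sum.cong refl prob_recorded(2)[OF h]) auto
  also have "\<dots> = p ^ N"
    by (simp add: sum_words_weight sum_slot_weight p_def x_def)
  finally have "prob (captured h N) = p ^ N" .
  moreover have "1 + real N * (p - 1) \<le> p ^ N"
    using Bernoulli_inequality[of "p - 1" N] x by (simp add: p_def)
  moreover have "1 - x\<^sup>2 \<le> p"
  proof -
    have "(1 + x) * (1 - x) \<le> (1 + x) * exp (- x)"
      using exp_ge_add_one_self[of "- x"] x by (intro mult_left_mono) auto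
    then show ?thesis by (simp add: p_def power2_eq_square algebra_simps)
  qed
  then have "real N * (1 - p) \<le> real N * x\<^sup>2" by (intro mult_left_mono) auto
  ultimately show ?thesis
    using prob_compl[OF captured_events[OF h N]] by (simp add: x_def algebra_simps)
qed

text \<open>The time spent in \<open>S\<close> up to the horizon, rounded to whole slots and set to \<open>0\<close> where one of
  these slots contains two contacts. As a sum over words it is measurable whatever the trajectory is.\<close>

definition occupation :: "(nat \<Rightarrow> node_state) set \<Rightarrow> real \<Rightarrow> nat \<Rightarrow> 'w \<Rightarrow> ennreal" where
  "occupation S h N \<omega> = (\<Sum>ls\<in>words (slot_labels n) N.
     ennreal (h * visits apply_contact S ls x0) * indicator (recorded h ls) \<omega>)"

lemma occupation_ge:
  assumes "ls \<in> words (slot_labels n) N" "\<omega> \<in> recorded h ls"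
  shows "ennreal (h * visits apply_contact S ls x0) \<le> occupation S h N \<omega>"
proof -
  have "ennreal (h * visits apply_contact S ls x0)
      = ennreal (h * visits apply_contact S ls x0) * indicator (recorded h ls) \<omega>"
    using assms by simp
  also have "\<dots> \<le> occupation S h N \<omega>"
    unfolding occupation_def using assms finite_words by (intro member_le_sum) auto
  finally show ?thesis .
qed

lemma occupation_measurable: "0 < h \<Longrightarrow> 0 < N \<Longrightarrow> occupation S h N \<in> borel_measurable M"
  unfolding occupation_def using prob_recorded(1)
  by (intro borel_measurable_sum borel_measurable_times borel_measurable_const borel_measurable_indicator) auto

end

section \<open>From drift to duration\<close>

text \<open>The last assumption says that the generator of the process, applied to \<open>V\<close>, is at most \<open>-1\<close>
  on \<open>S\<close> and at most \<open>0\<close> elsewhere, on all states that satisfy the invariant.\<close>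

locale drift_bound = uniform_consensus +
  fixes S :: "(nat \<Rightarrow> node_state) set" and V :: "(nat \<Rightarrow> node_state) \<Rightarrow> real"
    and Inv :: "(nat \<Rightarrow> node_state) \<Rightarrow> bool"
  assumes Inv_x0: "Inv x0"
    and Inv_step: "l \<in> slot_labels n \<Longrightarrow> Inv y \<Longrightarrow> Inv (apply_contact l y)"
    and V_nonneg: "Inv y \<Longrightarrow> 0 \<le> V y"
    and drift: "Inv y \<Longrightarrow> of_bool (y \<in> S) \<le> r * (\<Sum>e\<in>node_pairs n. V y - V (apply_contact (Some e) y))"
begin

text \<open>A slot is empty with probability \<open>exp (- x)\<close> and contains just the contact of a given pair with
  probability \<open>r h exp (- x)\<close>. One slot therefore lowers the mean of \<open>V\<close> by \<open>h exp (- x)\<close> on \<open>S\<close>,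
  which is the cost per visit here; the factor \<open>exp x\<close> compensates for the difference to \<open>h\<close>.\<close>

lemma integral_occupation:
  assumes h: "0 < h" and N: "0 < N"
  shows "(\<integral>\<^sup>+\<omega>. occupation S h N \<omega> \<partial>M) \<le> ennreal (exp (r * h * card (node_pairs n)) * V x0)"
proof -
  define K where "K = card (node_pairs n)"
  define x where "x = r * h * K"
  define w :: "nat set option \<Rightarrow> real" where "w = slot_weight r h K"
  have x: "0 \<le> x" using r_nonneg h by (simp add: x_def)
  have w: "0 \<le> w l" for l
    using r_nonneg h by (auto simp: w_def slot_weight_def split: option.split)
  have total: "(1 + x) * exp (- x) \<le> 1"
    using exp_ge_add_one_self[of x] by (simp add: exp_minus field_simps)
  have "(h * exp (- x)) * (\<Sum>ls\<in>words (slot_labels n) N. prod_list (map w ls) * visits apply_contact S ls x0) \<le> V x0"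
  proof (rule sum_visits_le[where Inv=Inv])
    fix y assume y: "Inv y"
    define D where "D = (\<Sum>e\<in>node_pairs n. V (apply_contact (Some e) y))"
    have "h * of_bool (y \<in> S) \<le> h * (r * (K * V y - D))"
      using drift[OF y] h unfolding D_def K_def
      by (intro mult_left_mono) (auto simp: sum_subtractf)
    then have "V y + r * h * D + h * of_bool (y \<in> S) \<le> (1 + x) * V y"
      by (simp add: x_def algebra_simps)
    from mult_right_mono[OF this, of "exp (- x)"]
    have "exp (- x) * (V y + r * h * D) + h * exp (- x) * of_bool (y \<in> S) \<le> (1 + x) * exp (- x) * V y"
      by (simp add: algebra_simps)
    also have "(1 + x) * exp (- x) * V y \<le> V y"
      using mult_right_mono[OF total V_nonneg[OF y]] by simp
    also have "exp (- x) * (V y + r * h * D) = (\<Sum>l\<in>slot_labels n. w l * V (apply_contact l y))"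
    proof -
      have "w None = exp (- x)" "w (Some e) = exp (- x) * (r * h)" for e
        by (simp_all add: w_def slot_weight_def x_def mult_ac)
      then show ?thesis
        by (simp add: sum_slot_labels D_def distrib_left sum_distrib_left mult.assoc
            del: apply_contact.simps(2))
    qed
    finally show "(\<Sum>l\<in>slot_labels n. w l * V (apply_contact l y)) + h * exp (- x) * of_bool (y \<in> S) \<le> V y" .
  qed (use w h x total Inv_step V_nonneg Inv_x0 in
      \<open>auto simp: w_def K_def x_def sum_slot_weight simp del: of_nat_mult\<close>)
  then have bound: "h * (\<Sum>ls\<in>words (slot_labels n) N. prod_list (map w ls) * visits apply_contact S ls x0) \<le> exp x * V x0"
    by (simp add: exp_minus field_simps)
  have "(\<integral>\<^sup>+\<omega>. occupation S h N \<omega> \<partial>M) = (\<Sum>ls\<in>words (slot_labels n) N.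
      ennreal (h * visits apply_contact S ls x0) * emeasure M (recorded h ls))"
    unfolding occupation_def using prob_recorded(1)[OF h] N
    by (subst nn_integral_sum) (auto simp: nn_integral_cmult_indicator intro!: sum.cong)
  also have "\<dots> = (\<Sum>ls\<in>words (slot_labels n) N.
      ennreal (h * (prod_list (map w ls) * visits apply_contact S ls x0)))"
    using h N prob_recorded(2)[OF h] w
    by (intro sum.cong refl)
      (auto simp: emeasure_eq_measure w_def K_def ennreal_mult[symmetric] mult_ac intro!: prod_list_nonneg)
  also have "\<dots> = ennreal (h * (\<Sum>ls\<in>words (slot_labels n) N. prod_list (map w ls) * visits apply_contact S ls x0))"
    using h w by (subst sum_ennreal) (auto simp: sum_distrib_left intro!: mult_nonneg_nonneg prod_list_nonneg)
  also have "\<dots> \<le> ennreal (exp x * V x0)"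
    using bound by (rule ennreal_leI)
  finally show ?thesis by (simp add: x_def K_def)
qed

text \<open>Subtracting \<open>B\<close> makes one statement serve both phases: \<open>B\<close> is \<open>0\<close> for phase 1 and the
  end of phase 1 for phase 2. The measurable bound is the lower limit of the occupation times. It is kept in
  the conclusion because almost sure finiteness follows from a finite integral only for measurable
  functions, and phase 2 needs that finiteness of the end of phase 1.\<close>

lemma duration_bound:
  fixes A B :: "'a \<Rightarrow> ennreal"
  assumes covered: "AE \<omega> in M. \<forall>h ls. recorded_trajectory n (\<lambda>e. C e \<omega>) x0 (\<lambda>t. X t \<omega>) h ls \<longrightarrow>
      min (A \<omega>) (ennreal (real (length ls) * h))
        \<le> B \<omega> + ennreal h + ennreal (h * visits apply_contact S ls x0)"
    and B: "AE \<omega> in M. B \<omega> \<noteq> \<infinity>"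
  shows "\<exists>U\<in>borel_measurable M. (AE \<omega> in M. A \<omega> - B \<omega> \<le> U \<omega>) \<and> (\<integral>\<^sup>+\<omega>. U \<omega> \<partial>M) \<le> ennreal (V x0)"
proof -
  \<comment> \<open>The choice gives \<open>N h = (3/2)^k\<close>, which is unbounded, and \<open>N h^2 = (3/4)^k\<close>, which is summable.\<close>
  define h :: "nat \<Rightarrow> real" where "h k = (1/2) ^ k" for k
  define N :: "nat \<Rightarrow> nat" where "N k = 3 ^ k" for k
  define K where "K = card (node_pairs n)"
  have hN: "0 < h k" "0 < N k" for k by (auto simp: h_def N_def)
  define u where "u k \<omega> = ennreal (h k) + occupation S (h k) (N k) \<omega>" for k \<omega>
  define U where "U \<omega> = liminf (\<lambda>k. u k \<omega>)" for \<omega>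
  have u_meas: "u k \<in> borel_measurable M" for k
    unfolding u_def using occupation_measurable[OF hN] by simp
  have "(\<integral>\<^sup>+\<omega>. U \<omega> \<partial>M) \<le> liminf (\<lambda>k. \<integral>\<^sup>+\<omega>. u k \<omega> \<partial>M)"
    unfolding U_def by (rule nn_integral_liminf[OF u_meas])
  also have "\<dots> \<le> liminf (\<lambda>k. ennreal (h k + exp (r * h k * K) * V x0))"
  proof (rule Liminf_mono, rule always_eventually, rule allI)
    fix k
    have "(\<integral>\<^sup>+\<omega>. u k \<omega> \<partial>M) = ennreal (h k) + (\<integral>\<^sup>+\<omega>. occupation S (h k) (N k) \<omega> \<partial>M)"
      unfolding u_def using occupation_measurable[OF hN]
      by (subst nn_integral_add) (auto simp: emeasure_space_1)
    also have "\<dots> \<le> ennreal (h k) + ennreal (exp (r * h k * K) * V x0)"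
      unfolding K_def by (intro add_left_mono integral_occupation hN)
    finally show "(\<integral>\<^sup>+\<omega>. u k \<omega> \<partial>M) \<le> ennreal (h k + exp (r * h k * K) * V x0)"
      using hN(1)[of k] V_nonneg[OF Inv_x0] by simp
  qed
  also have "\<dots> = ennreal (V x0)"
  proof (rule lim_imp_Liminf)
    have h0: "h \<longlonglongrightarrow> 0" unfolding h_def by (rule LIMSEQ_power_zero) simp
    have "(\<lambda>k. h k + exp (r * h k * K) * V x0) \<longlonglongrightarrow> 0 + exp (r * 0 * K) * V x0"
      by (intro tendsto_intros h0)
    then show "(\<lambda>k. ennreal (h k + exp (r * h k * K) * V x0)) \<longlonglongrightarrow> ennreal (V x0)"
      by (intro tendsto_ennrealI) simp
  qed simp
  finally have int: "(\<integral>\<^sup>+\<omega>. U \<omega> \<partial>M) \<le> ennreal (V x0)" .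
  have T: "filterlim (\<lambda>k. real (N k) * h k) at_top sequentially"
  proof -
    have "real (N k) * h k = (3/2) ^ k" for k
      by (simp only: N_def h_def of_nat_power power_mult_distrib[symmetric]) simp
    then show ?thesis
      using filterlim_realpow_sequentially_gt1[of "3/2::real"] filterlim_at_infinity_imp_filterlim_at_top[of "\<lambda>k. (3/2::real)^k" sequentially] by simp
  qed
  have "AE \<omega> in M. \<forall>\<^sub>F k in sequentially. \<omega> \<in> space M - (space M - captured (h k) (N k))"
  proof (rule borel_cantelli_AE1)
    show "summable (\<lambda>k. prob (space M - captured (h k) (N k)))"
    proof (rule summable_comparison_test')
      show "summable (\<lambda>k. (r * K)\<^sup>2 * (3/4) ^ k)"
        by (intro summable_mult summable_geometric) simp
      show "norm (prob (space M - captured (h k) (N k))) \<le> (r * K)\<^sup>2 * (3/4) ^ k" if "0 \<le> k" for k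
      proof -
        have "real (N k) * (r * h k * K)\<^sup>2 = (r * K)\<^sup>2 * (3 ^ k * ((1/2) ^ k)\<^sup>2)"
          by (simp add: N_def h_def power_mult_distrib)
        also have "(3 ^ k * ((1/2) ^ k)\<^sup>2 :: real) = (3/4) ^ k"
          by (simp only: power2_eq_square power_mult_distrib[symmetric]) simp
        finally show ?thesis
          using prob_not_captured[OF hN, of k k] by (simp add: K_def)
      qed
    qed
  qed (use captured_events[OF hN] in \<open>auto simp: emeasure_eq_measure\<close>)
  then have "AE \<omega> in M. A \<omega> - B \<omega> \<le> U \<omega>"
    using covered B trajectory
  proof eventually_elim
    case (elim \<omega>)
    note covered' = elim(2)[rule_format] and traj' = elim(4)
    show ?case
      unfolding U_def le_Liminf_iff
    proof (intro allI impI)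
      fix z assume z: "z < A \<omega> - B \<omega>"
      then have zB: "z + B \<omega> < A \<omega>"
        using \<open>B \<omega> \<noteq> \<infinity>\<close> by (metis add.commute ennreal_minus_le_iff infinity_ennreal_def not_le)
      then have "z + B \<omega> \<noteq> \<infinity>" by auto
      then obtain a where a: "z + B \<omega> = ennreal a" "0 \<le> a" by (cases "z + B \<omega>") auto
      have "\<forall>\<^sub>F k in sequentially. a < real (N k) * h k"
        using T by (simp add: filterlim_at_top_dense)
      then show "\<forall>\<^sub>F k in sequentially. z < u k \<omega>"
        using elim(1)
      proof eventually_elim
        case (elim k)
        then obtain ls where ls: "ls \<in> words (slot_labels n) (N k)" "\<omega> \<in> recorded (h k) ls"
          by (auto simp: captured_def)
        have "recorded_trajectory n (\<lambda>e. C e \<omega>) x0 (\<lambda>t. X t \<omega>) (h k) ls"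
          using ls hN traj' finite_contacts
          by unfold_locales (auto simp: recorded_def)
        then have "min (A \<omega>) (ennreal (real (N k) * h k))
            \<le> B \<omega> + ennreal (h k) + ennreal (h k * visits apply_contact S ls x0)"
          using covered'[of "h k" ls] ls by simp
        also have "\<dots> \<le> B \<omega> + u k \<omega>"
          unfolding u_def using occupation_ge[OF ls, of S] by (simp add: add.assoc add_left_mono)
        finally have "min (A \<omega>) (ennreal (real (N k) * h k)) \<le> B \<omega> + u k \<omega>" .
        moreover have "z + B \<omega> < min (A \<omega>) (ennreal (real (N k) * h k))"
          using zB elim a by (simp add: ennreal_lessI)
        ultimately have "z + B \<omega> < B \<omega> + u k \<omega>" by (rule less_le_trans[rotated])
        then show ?case by (metis add.commute add_left_mono not_le)
      qed
    qed
  qed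
  moreover have "U \<in> borel_measurable M"
    unfolding U_def using u_meas by simp
  ultimately show ?thesis using int by blast
qed

end

section \<open>Potentials on the complete graph\<close>

text \<open>Each of the pairs with one node in \<open>P\<close> and one in \<open>Q\<close> contributes at least \<open>\<delta>\<close>, and all other
  pairs contribute at least \<open>0\<close>. Disjointness ensures that no pair is counted twice.\<close>

lemma sum_drop_ge:
  fixes V :: "(nat \<Rightarrow> node_state) \<Rightarrow> real"
  assumes sub: "P \<subseteq> {1..n}" "Q \<subseteq> {1..n}" and disj: "P \<inter> Q = {}"
    and mono: "\<And>i j. i \<in> {1..n} \<Longrightarrow> j \<in> {1..n} \<Longrightarrow> i \<noteq> j \<Longrightarrow> V (meet i j y) \<le> V y"
    and drop: "\<And>i j. i \<in> P \<Longrightarrow> j \<in> Q \<Longrightarrow> V (meet i j y) + \<delta> \<le> V y"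
  shows "real (card P) * real (card Q) * \<delta> \<le> (\<Sum>e\<in>node_pairs n. V y - V (apply_contact (Some e) y))"
proof -
  have inj: "inj_on (\<lambda>(i, j). {i, j}) (P \<times> Q)"
    using disj by (auto simp: inj_on_def doubleton_eq_iff)
  have "real (card P) * real (card Q) * \<delta> = (\<Sum>(i, j)\<in>P \<times> Q. \<delta>)"
    by (simp add: card_cartesian_product)
  also have "\<dots> \<le> (\<Sum>(i, j)\<in>P \<times> Q. V y - V (apply_contact (Some {i, j}) y))"
  proof (intro sum_mono, clarify)
    fix i j assume "i \<in> P" "j \<in> Q"
    moreover from this have "i \<noteq> j" using disj by blast
    ultimately show "\<delta> \<le> V y - V (apply_contact (Some {i, j}) y)"
      using drop[of i j] by (simp add: apply_contact_pair del: apply_contact.simps(2))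
  qed
  also have "\<dots> = (\<Sum>e\<in>(\<lambda>(i, j). {i, j}) ` (P \<times> Q). V y - V (apply_contact (Some e) y))"
    by (subst sum.reindex[OF inj]) (simp add: case_prod_unfold)
  also have "\<dots> \<le> (\<Sum>e\<in>node_pairs n. V y - V (apply_contact (Some e) y))"
  proof (rule sum_mono2[OF finite_node_pairs])
    show "(\<lambda>(i, j). {i, j}) ` (P \<times> Q) \<subseteq> node_pairs n"
    proof clarify
      fix i j assume "i \<in> P" "j \<in> Q"
      then show "{i, j} \<in> node_pairs n"
        using sub disj unfolding node_pairs_def by blast
    qed
    show "0 \<le> V y - V (apply_contact (Some e) y)" if "e \<in> node_pairs n - (\<lambda>(i, j). {i, j}) ` (P \<times> Q)" for e
      using that mono by (auto elim!: node_pairsE simp: apply_contact_pair simp del: apply_contact.simps(2))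
  qed
  finally show ?thesis .
qed

lemma harm_le_ln: "0 < n \<Longrightarrow> harm n \<le> ln (real n) + 1"
  using euler_mascheroni_sequence_decreasing[of 1 n] by (simp add: harm_def)

lemma harm_pred: "0 < b \<Longrightarrow> Suc a = b \<Longrightarrow> harm a + 1 / real b = harm b"
  by (auto simp: harm_Suc inverse_eq_divide)

lemma state_count_le: "state_count n s y \<le> n"
proof -
  have "state_count n s y \<le> card {1..n}"
    unfolding state_count_def by (rule card_mono) auto
  then show ?thesis by simp
qed

locale complete_graph_consensus = uniform_consensus +
  fixes d :: real
  assumes n: "1 < n" and r: "r = 1 / (real n - 1)" and d: "0 < d"
    and balance: "real (state_count n Zero x0) - real (state_count n One x0) = d"
begin

definition balanced :: "(nat \<Rightarrow> node_state) \<Rightarrow> bool" where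
  "balanced y \<longleftrightarrow> real (state_count n Zero y) - real (state_count n One y) = d"

lemma balanced_step: "l \<in> slot_labels n \<Longrightarrow> balanced y \<Longrightarrow> balanced (apply_contact l y)"
proof (rule apply_contact_cases[where P=balanced])
  fix i j assume "balanced y" "i \<in> {1..n}" "j \<in> {1..n}" "i \<noteq> j"
  then show "balanced (meet i j y)"
    using meet_balance[of i n j y] unfolding balanced_def by linarith
qed

definition phase1_potential :: "(nat \<Rightarrow> node_state) \<Rightarrow> real" where
  "phase1_potential y = (real n - 1) / d * harm (state_count n One y)"

text \<open>Before phase 2 the number of nodes in state \<^const>\<open>E1\<close> can rise, so the potential starts at its
  largest possible value and stays there until phase 1 is over.\<close>

definition phase2_potential :: "(nat \<Rightarrow> node_state) \<Rightarrow> real" where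
  "phase2_potential y = (real n - 1) / d *
     harm (if state_count n One y = 0 then state_count n E1 y else n)"

lemma phase1_potential_mono:
  assumes "i \<in> {1..n}" "j \<in> {1..n}" "i \<noteq> j"
  shows "phase1_potential (meet i j y) \<le> phase1_potential y"
  unfolding phase1_potential_def using n d meet_One_le[OF assms]
  by (intro mult_left_mono harm_mono) auto

lemma phase2_potential_mono:
  assumes "i \<in> {1..n}" "j \<in> {1..n}" "i \<noteq> j"
  shows "phase2_potential (meet i j y) \<le> phase2_potential y"
  unfolding phase2_potential_def
  using n d meet_One_le[OF assms, of y] meet_E1_le[OF assms, of y] state_count_le[of n]
  by (intro mult_left_mono harm_mono) auto

text \<open>There are \<open>a b\<close> pairs with one node in state \<^const>\<open>Zero\<close> and one in state \<^const>\<open>One\<close>, each of which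
  lowers the potential by \<open>(n - 1) / (d b)\<close> and meets at rate \<open>1 / (n - 1)\<close>. The total \<open>a / d\<close> is at
  least \<open>1\<close> by balance.\<close>

lemma phase1_drift:
  assumes y: "balanced y"
  shows "of_bool (y \<in> phase1_states n)
    \<le> r * (\<Sum>e\<in>node_pairs n. phase1_potential y - phase1_potential (apply_contact (Some e) y))"
    (is "_ \<le> r * ?D")
proof -
  define a where "a = state_count n Zero y"
  define b where "b = state_count n One y"
  have "real a * real b * ((real n - 1) / d * (1 / real b)) \<le> ?D" if "b \<noteq> 0"
    unfolding a_def b_def state_count_def[of n _ y]
  proof (rule sum_drop_ge)
    fix i j assume "i \<in> {i \<in> {1..n}. y i = Zero}" "j \<in> {i \<in> {1..n}. y i = One}"
    then have "Suc (state_count n One (meet i j y)) = b"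
      unfolding b_def by (intro meet_Zero_One) auto
    from harm_pred[OF _ this] that
    have eq: "harm (state_count n One (meet i j y)) + 1 / real b = harm b" by simp
    then have "phase1_potential (meet i j y) + (real n - 1) / d * (1 / real b) \<le> phase1_potential y"
      unfolding phase1_potential_def b_def[symmetric] distrib_left[symmetric]
      by (simp only: eq order_refl)
    then show "phase1_potential (meet i j y) + (real n - 1) / d * (1 / real (card {i \<in> {1..n}. y i = One}))
        \<le> phase1_potential y"
      by (simp only: b_def state_count_def[of n _ y])
  qed (auto intro: phase1_potential_mono)
  moreover have "real n - 1 \<le> real a * real b * ((real n - 1) / d * (1 / real b))" if "b \<noteq> 0"
  proof -
    have "d \<le> real a" using y by (simp add: balanced_def a_def)
    then have "1 * (real n - 1) \<le> real a / d * (real n - 1)"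
      using d n by (intro mult_right_mono) auto
    then show ?thesis using that by simp
  qed
  moreover have "0 \<le> ?D"
    by (intro sum_nonneg) (auto elim!: node_pairsE simp: apply_contact_pair phase1_potential_mono
        simp del: apply_contact.simps(2))
  ultimately show ?thesis
    using n by (auto simp: r b_def phase1_states_def field_simps)
qed

text \<open>As in phase 1, with \<^const>\<open>E1\<close> in place of \<^const>\<open>One\<close>; the total \<open>a / d\<close> is exactly \<open>1\<close>, as no
  node is in state \<^const>\<open>One\<close>.\<close>

lemma phase2_drift:
  assumes y: "balanced y"
  shows "of_bool (y \<in> phase2_states n)
    \<le> r * (\<Sum>e\<in>node_pairs n. phase2_potential y - phase2_potential (apply_contact (Some e) y))"
    (is "_ \<le> r * ?D")
proof -
  define a where "a = state_count n Zero y"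
  define b where "b = state_count n E1 y"
  have "real a * real b * ((real n - 1) / d * (1 / real b)) \<le> ?D"
    if one: "state_count n One y = 0" and b: "b \<noteq> 0"
    unfolding a_def b_def state_count_def[of n _ y]
  proof (rule sum_drop_ge)
    fix i j assume ij: "i \<in> {i \<in> {1..n}. y i = Zero}" "j \<in> {i \<in> {1..n}. y i = E1}"
    then have "Suc (state_count n E1 (meet i j y)) = b"
      unfolding b_def by (intro meet_Zero_E1) auto
    from harm_pred[OF _ this] b
    have eq: "harm (state_count n E1 (meet i j y)) + 1 / real b = harm b" by simp
    have "i \<noteq> j" using ij by auto
    then have "state_count n One (meet i j y) = 0"
      using meet_One_le[of i n j y] ij one by simp
    then have "phase2_potential (meet i j y) + (real n - 1) / d * (1 / real b) \<le> phase2_potential y"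
      unfolding phase2_potential_def b_def[symmetric]
      by (simp only: one eq if_True simp_thms distrib_left[symmetric] order_refl)
    then show "phase2_potential (meet i j y) + (real n - 1) / d * (1 / real (card {i \<in> {1..n}. y i = E1}))
        \<le> phase2_potential y"
      by (simp only: b_def state_count_def[of n _ y])
  qed (auto intro: phase2_potential_mono)
  moreover have "real n - 1 = real a * real b * ((real n - 1) / d * (1 / real b))"
    if "state_count n One y = 0" "b \<noteq> 0"
  proof -
    have "real a = d" using y that by (simp add: balanced_def a_def)
    then show ?thesis using that d by simp
  qed
  moreover have "0 \<le> ?D"
    by (intro sum_nonneg) (auto elim!: node_pairsE simp: apply_contact_pair phase2_potential_mono
        simp del: apply_contact.simps(2))
  ultimately show ?thesis
    using n by (auto simp: r b_def phase2_states_def field_simps)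
qed

lemma potential_le:
  shows "phase1_potential y \<le> (real n - 1) / d * (ln (real n) + 1)"
    and "phase2_potential y \<le> (real n - 1) / d * (ln (real n) + 1)"
proof -
  have "harm m \<le> ln (real n) + 1" if "m \<le> n" for m
    using harm_mono[OF that, where ?'a=real] harm_le_ln[of n] n by linarith
  then show "phase1_potential y \<le> (real n - 1) / d * (ln (real n) + 1)"
    and "phase2_potential y \<le> (real n - 1) / d * (ln (real n) + 1)"
    unfolding phase1_potential_def phase2_potential_def
    using n d state_count_le[of n] by (intro mult_left_mono; simp)+
qed

sublocale phase1: drift_bound M n q C x0 X r "phase1_states n" phase1_potential balanced
proof unfold_locales
  show "balanced x0" using balance by (simp add: balanced_def)
  show "0 \<le> phase1_potential y" for y
    unfolding phase1_potential_def using n d by (intro mult_nonneg_nonneg harm_nonneg) simp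
qed (fact balanced_step phase1_drift)+

sublocale phase2: drift_bound M n q C x0 X r "phase2_states n" phase2_potential balanced
proof unfold_locales
  show "balanced x0" using balance by (simp add: balanced_def)
  show "0 \<le> phase2_potential y" for y
    unfolding phase2_potential_def using n d by (intro mult_nonneg_nonneg harm_nonneg) simp
qed (fact balanced_step phase2_drift)+

lemma phase1_end_measurable_bound:
  "\<exists>U\<in>borel_measurable M. (AE \<omega> in M. phase1_end n (\<lambda>t. X t \<omega>) \<le> U \<omega>) \<and>
     (\<integral>\<^sup>+\<omega>. U \<omega> \<partial>M) \<le> ennreal (phase1_potential x0)"
proof -
  have "AE \<omega> in M. \<forall>h ls. recorded_trajectory n (\<lambda>e. C e \<omega>) x0 (\<lambda>t. X t \<omega>) h ls \<longrightarrow>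
      min (phase1_end n (\<lambda>t. X t \<omega>)) (ennreal (real (length ls) * h))
        \<le> 0 + ennreal h + ennreal (h * visits apply_contact (phase1_states n) ls x0)"
    by (intro AE_I2 allI impI)
      (auto intro: order_trans[OF recorded_trajectory.phase1_end_le_visits] add_increasing)
  from phase1.duration_bound[OF this] show ?thesis by simp
qed

theorem expected_durations:
  shows "(\<integral>\<^sup>+\<omega>. phase1_duration n (\<lambda>t. X t \<omega>) \<partial>M) \<le> ennreal ((real n - 1) / d * (ln (real n) + 1))"
    and "(\<integral>\<^sup>+\<omega>. phase2_duration n (\<lambda>t. X t \<omega>) \<partial>M) \<le> ennreal ((real n - 1) / d * (ln (real n) + 1))"
proof -
  obtain U where U: "U \<in> borel_measurable M" "AE \<omega> in M. phase1_end n (\<lambda>t. X t \<omega>) \<le> U \<omega>"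
    "(\<integral>\<^sup>+\<omega>. U \<omega> \<partial>M) \<le> ennreal (phase1_potential x0)"
    using phase1_end_measurable_bound by blast
  have "(\<integral>\<^sup>+\<omega>. phase1_duration n (\<lambda>t. X t \<omega>) \<partial>M) \<le> (\<integral>\<^sup>+\<omega>. U \<omega> \<partial>M)"
    unfolding phase1_duration_def by (rule nn_integral_mono_AE[OF U(2)])
  also note U(3)
  also have "ennreal (phase1_potential x0) \<le> ennreal ((real n - 1) / d * (ln (real n) + 1))"
    by (rule ennreal_leI[OF potential_le(1)])
  finally show "(\<integral>\<^sup>+\<omega>. phase1_duration n (\<lambda>t. X t \<omega>) \<partial>M) \<le> ennreal ((real n - 1) / d * (ln (real n) + 1))" .
  have "(\<integral>\<^sup>+\<omega>. U \<omega> \<partial>M) \<noteq> \<infinity>"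
    using U(3) by (auto simp: top_unique)
  from nn_integral_PInf_AE[OF U(1) this] U(2)
  have fin: "AE \<omega> in M. phase1_end n (\<lambda>t. X t \<omega>) \<noteq> \<infinity>"
    by eventually_elim (auto simp: top_unique)
  have "AE \<omega> in M. \<forall>h ls. recorded_trajectory n (\<lambda>e. C e \<omega>) x0 (\<lambda>t. X t \<omega>) h ls \<longrightarrow>
      min (phase2_end n (\<lambda>t. X t \<omega>)) (ennreal (real (length ls) * h))
        \<le> phase1_end n (\<lambda>t. X t \<omega>) + ennreal h + ennreal (h * visits apply_contact (phase2_states n) ls x0)"
    by (intro AE_I2 allI impI recorded_trajectory.phase2_end_le_visits)
  from phase2.duration_bound[OF this fin] obtain W where W:
    "AE \<omega> in M. phase2_end n (\<lambda>t. X t \<omega>) - phase1_end n (\<lambda>t. X t \<omega>) \<le> W \<omega>"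
    "(\<integral>\<^sup>+\<omega>. W \<omega> \<partial>M) \<le> ennreal (phase2_potential x0)" by blast
  have "(\<integral>\<^sup>+\<omega>. phase2_duration n (\<lambda>t. X t \<omega>) \<partial>M) \<le> (\<integral>\<^sup>+\<omega>. W \<omega> \<partial>M)"
    unfolding phase2_duration_def by (rule nn_integral_mono_AE[OF W(1)])
  also note W(2)
  also have "ennreal (phase2_potential x0) \<le> ennreal ((real n - 1) / d * (ln (real n) + 1))"
    by (rule ennreal_leI[OF potential_le(2)])
  finally show "(\<integral>\<^sup>+\<omega>. phase2_duration n (\<lambda>t. X t \<omega>) \<partial>M) \<le> ennreal ((real n - 1) / d * (ln (real n) + 1))" .
qed

end

theorem corollary1:
  fixes M :: "'w measure"
    and n :: nat
    and \<alpha> :: real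
    and q :: "nat \<Rightarrow> nat \<Rightarrow> real"
    and C :: "nat set \<Rightarrow> 'w \<Rightarrow> real set"
    and x0 :: "nat \<Rightarrow> node_state"
    and X :: "real \<Rightarrow> 'w \<Rightarrow> nat \<Rightarrow> node_state"
  assumes "n > 1"
    and "1 / 2 < \<alpha>" and "\<alpha> \<le> 1" and "\<alpha> * real n \<in> \<int>"
    and "interval_consensus M n q C x0 X"
    and "\<And>i j. i \<in> {1..n} \<Longrightarrow> j \<in> {1..n} \<Longrightarrow> i \<noteq> j \<Longrightarrow> q i j = 1 / (real n - 1)"
    and "real (card {i \<in> {1..n}. x0 i = Zero}) = \<alpha> * real n"
    and "real (card {i \<in> {1..n}. x0 i = One}) = (1 - \<alpha>) * real n"
  shows "(\<integral>\<^sup>+ \<omega>. phase1_duration n (\<lambda>t. X t \<omega>) \<partial>M)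
           \<le> ennreal (1 / (2 * \<alpha> - 1) * (ln (real n) + 1)) \<and>
         (\<integral>\<^sup>+ \<omega>. phase2_duration n (\<lambda>t. X t \<omega>) \<partial>M)
           \<le> ennreal (1 / (2 * \<alpha> - 1) * (ln (real n) + 1))"
proof -
  define d where "d = (2 * \<alpha> - 1) * real n"
  have pairs: "node_pairs n \<noteq> {}"
  proof -
    have "{1, 2} \<in> node_pairs n"
      unfolding node_pairs_def using assms(1) by (intro CollectI exI[of _ 1] exI[of _ 2]) auto
    then show ?thesis by blast
  qed
  interpret interval_consensus M n q C x0 X by fact
  interpret complete_graph_consensus M n q C x0 X "1 / (real n - 1)" d
  proof unfold_locales
    show "real (state_count n Zero x0) - real (state_count n One x0) = d"
      unfolding state_count_def assms(7,8) d_def by (simp add: algebra_simps)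
    show "q i j = 1 / (real n - 1)" if "i \<in> {1..n}" "j \<in> {1..n}" "i \<noteq> j" for i j
      using that by (rule assms(6))
  qed (use assms(1,2) pairs in \<open>auto simp: d_def\<close>)
  have "(real n - 1) / d * (ln (real n) + 1) \<le> 1 / (2 * \<alpha> - 1) * (ln (real n) + 1)"
    using assms(1,2) by (intro mult_right_mono) (auto simp: d_def field_simps)
  from expected_durations[THEN order_trans, OF ennreal_leI[OF this]]
  show ?thesis by blast
qed


end
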